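(* In the absence of the external force ($\mathscr F=\bm 0$), the following hold. (i) Let the fully discrete BDF1 scheme hold: given $\bm U^0\in[V_{ew};V_{ns}]$, for $0\le n\le N_t-1$, $\bm U^{n+1}\in[V_{ew};V_{ns}]$ and $P^{n+1}\in V_c$ satisfy $$\frac{\bm U^{n+1}-\bm U^n}{\tau}-\nu\Delta_h\bm U^{n+1}+\bm B(\bm U^n,\bm U^{n+1})+\nabla_DP^{n+1}=\mathscr F^{n+1},\qquad \nabla_d\cdot\bm U^{n+1}=\bm 0 .$$ Then for $0\le n\le N_t-1$, $$\frac{E_h^{n+1}-E_h^n}{\tau}=\nu\big(\Delta_h\bm U^{n+1},\bm U^{n+1}\big)_h-\frac1{2\tau}\|\bm U^{n+1}-\bm U^n\|_h^2,\qquad E_h^n=\frac12\|\bm U^n\|_h^2 .$$ (ii) Let the fully discrete BDF2 scheme hold: given $\bm U^0\in[V_{ew};V_{ns}]$, and $\bm U^1$ obtained from the BDF1 scheme, for $1\le n\le N_t-1$, $\bm U^{n+1}\in[V_{ew};V_{ns}]$ and $P^{n+1}\in V_c$ satisfy $$\frac{3\bm U^{n+1}-4\bm U^n+\bm U^{n-1}}{2\tau}-\nu\Delta_h\bm U^{n+1}+\bm B(\overline{\bm U}^{n+1},\bm U^{n+1})+\nabla_DP^{n+1}=\mathscr F^{n+1},\qquad \nabla_d\cdot\bm U^{n+1}=\bm 0,$$ with $\overline{\bm U}^{n+1}=2\bm U^n-\bm U^{n-1}$. Then for $1\le n\le N_t-1$, $$\frac{\widehat E_h^{n+1}-\widehat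 E_h^n}{\tau}=\nu\big(\Delta_h\bm U^{n+1},\bm U^{n+1}\big)_h-\frac1{4\tau}\|\bm U^{n+1}-2\bm U^n+\bm U^{n-1}\|_h^2,$$ where $\widehat E_h^n=\frac14\left(\|\bm U^n\|_h^2+\|2\bm U^n-\bm U^{n-1}\|_h^2\right)$.
   Context: Setting: two space dimensions with periodic boundary conditions on $[0,L_x]\times[0,L_y]$; $N_x,N_y,N_t$ are positive integers, $h_x=L_x/N_x$, $h_y=L_y/N_y$, $T>0$, $\tau=T/N_t$, $\nu>0$. $V_{ew},V_{ns},V_c$ are the spaces of real grid functions on, respectively, the points $(x_{i+1/2},y_j)$ ($0\le i\le N_x-1$, $1\le j\le N_y$), $(x_i,y_{j+1/2})$ ($1\le i\le N_x$, $0\le j\le N_y-1$), $(x_i,y_j)$ ($1\le i\le N_x$, $1\le j\le N_y$), where $x_l=(l-\frac12)h_x$, $y_l=(l-\frac12)h_y$; each is identified with the real $N_x\times N_y$ matrices. $[V_{ew};V_{ns}]$ is the space of pairs $\bm U=[U;V]$ with $U\in V_{ew}$, $V\in V_{ns}$. For matrices of equal size, $(A,B)_h=h_xh_y\mathrm{Tr}(A^TB)$, $\|A\|_h=\sqrt{(A,A)_h}$; for pairs, the inner products of the components are summed. Differentiation matrices ($N\times N$, acting on $w\in\mathbb R^N$ with indices modulo $N$): $(\mathbb C(N)w)_i=\frac12(w_i+w_{i+1})$, $(\mathbb D_1(N,h)w)_i=\frac{1}{2h}(w_{i+1}-w_{i-1})$, $(\mathbb D_2(N,h)w)_i=\frac1h(w_{i+1}-w_i)$,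 $(\mathbb D_3(N,h)w)_i=\frac1{h^2}(w_{i+1}-2w_i+w_{i-1})$. Put $\mathbb A_1=\mathbb C(N_x)$, $\mathbb A_2=\mathbb D_1(N_x,h_x)$, $\mathbb A_3=\mathbb D_2(N_x,h_x)$, $\mathbb A_4=\mathbb D_3(N_x,h_x)$, and $\mathbb B_1=\mathbb C(N_y)$, $\mathbb B_2=\mathbb D_1(N_y,h_y)$, $\mathbb B_3=\mathbb D_2(N_y,h_y)$, $\mathbb B_4=\mathbb D_3(N_y,h_y)$. Discrete operators: $\nabla_d\cdot\bm U=\mathbb A_3U+V\mathbb B_3^T\in V_c$; $\nabla_DP=[-\mathbb A_3^TP;\,-P\mathbb B_3]\in[V_{ew};V_{ns}]$; $\Delta_hW=\mathbb A_4W+W\mathbb B_4^T$, applied componentwise to pairs. $\bm F:[V_{ew};V_{ns}]\to[V_{ew};V_{ns}]$ is a given map with $(\bm F(\bm U),\bm U)_h\ne0$ whenever $\|\bm U\|_h\neq0$. $\bm G(\bm U)=[G_1(\bm U);G_2(\bm U)]$ is $\bm 0$ if $\|\bm U\|_h=0$, and otherwise $$G_1(\bm U)=\frac{U\odot(\mathbb A_2U)-\big((\mathbb A_1^TV)\odot(U\mathbb B_3)\big)\mathbb B_1^T}{(\bm F(\bm U),\bm U)_h},\qquad G_2(\bm U)=\frac{V\odot(V\mathbb B_2^T)-\mathbb A_1\big((\mathbb A_3^TV)\odot(U\mathbb B_1)\big)}{(\bm F(\bm U),\bm U)_h},$$ with $\odot$ the Hadamard (entrywise) product. For $\bm U,\bm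 W\in[V_{ew};V_{ns}]$, $$\bm B(\bm U,\bm W)=\big(\bm F(\bm U),\bm W\big)_h\bm G(\bm U)-\big(\bm G(\bm U),\bm W\big)_h\bm F(\bm U).$$ $\mathscr F^{n+1}\in[V_{ew};V_{ns}]$ is the spatial discretization of the external force. *)

theory Defs
  imports
    Complex_Main
    "HOL-Library.Product_Plus"
    "Jordan_Normal_Form.Matrix"
begin

text \<open>
  A grid function is stored as an \<open>Nx \<times> Ny\<close> matrix, for each of the three spaces
  \<open>V_ew\<close>, \<open>V_ns\<close> and \<open>V_c\<close>. Row \<open>k\<close> and column \<open>l\<close> (counted from \<open>0\<close>) hold the value at
  \<open>(x_(k+1/2), y_(l+1))\<close>, \<open>(x_(k+1), y_(l+1/2))\<close> and \<open>(x_(k+1), y_(l+1))\<close>, respectively.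
\<close>

type_synonym gridfun = "real mat"
type_synonym velocity = "gridfun \<times> gridfun"

definition velocity_space :: "nat \<Rightarrow> nat \<Rightarrow> velocity set" where
  "velocity_space Nx Ny = carrier_mat Nx Ny \<times> carrier_mat Nx Ny"

definition pressure_space :: "nat \<Rightarrow> nat \<Rightarrow> gridfun set" where
  "pressure_space Nx Ny = carrier_mat Nx Ny"

text \<open>Sums and differences of velocities are the componentwise ones of
  \<^theory>\<open>HOL-Library.Product_Plus\<close>.\<close>

definition vzero :: "nat \<Rightarrow> nat \<Rightarrow> velocity" where
  "vzero Nx Ny = (0\<^sub>m Nx Ny, 0\<^sub>m Nx Ny)"

definition vscale :: "real \<Rightarrow> velocity \<Rightarrow> velocity" (infixr \<open>*\<^sub>U\<close> 75) where
  "c *\<^sub>U W = (c \<cdot>\<^sub>m fst W, c \<cdot>\<^sub>m snd W)"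

definition mat_tr :: "real mat \<Rightarrow> real" where
  "mat_tr A = (\<Sum>i<dim_row A. A $$ (i, i))"

definition hadamard :: "real mat \<Rightarrow> real mat \<Rightarrow> real mat" (infixl \<open>\<odot>\<close> 70) where
  "A \<odot> B = mat (dim_row A) (dim_col A) (\<lambda>ij. A $$ ij * B $$ ij)"

definition grid_inner :: "real \<Rightarrow> real \<Rightarrow> gridfun \<Rightarrow> gridfun \<Rightarrow> real" where
  "grid_inner hx hy A B = hx * hy * mat_tr (transpose_mat A * B)"

definition vel_inner :: "real \<Rightarrow> real \<Rightarrow> velocity \<Rightarrow> velocity \<Rightarrow> real" where
  "vel_inner hx hy U W = grid_inner hx hy (fst U) (fst W) + grid_inner hx hy (snd U) (snd W)"

definition vel_norm :: "real \<Rightarrow> real \<Rightarrow> velocity \<Rightarrow> real" where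
  "vel_norm hx hy U = sqrt (vel_inner hx hy U U)"


text \<open>
  Each entry below is a sum of contributions, so that contributions falling on the same
  position add up; this happens for \<open>N \<le> 2\<close>, where neighbours modulo \<open>N\<close> coincide.
  The predecessor of \<open>i\<close> modulo \<open>N\<close> is \<open>(i + N - 1) mod N\<close>.
\<close>

definition avg_mat :: "nat \<Rightarrow> real mat" where
  "avg_mat N = mat N N (\<lambda>(i, j). (of_bool (j = i) + of_bool (j = (i + 1) mod N)) / 2)"

definition D1_mat :: "nat \<Rightarrow> real \<Rightarrow> real mat" where
  "D1_mat N h = mat N N (\<lambda>(i, j).
     (of_bool (j = (i + 1) mod N) - of_bool (j = (i + N - 1) mod N)) / (2 * h))"

definition D2_mat :: "nat \<Rightarrow> real \<Rightarrow> real mat" where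
  "D2_mat N h = mat N N (\<lambda>(i, j). (of_bool (j = (i + 1) mod N) - of_bool (j = i)) / h)"

definition D3_mat :: "nat \<Rightarrow> real \<Rightarrow> real mat" where
  "D3_mat N h = mat N N (\<lambda>(i, j).
     (of_bool (j = (i + 1) mod N) - 2 * of_bool (j = i) + of_bool (j = (i + N - 1) mod N)) / h\<^sup>2)"

lemma periodic_mat_actions:
  fixes w :: "real vec"
  assumes w: "w \<in> carrier_vec N" and i: "i < N"
  shows "(avg_mat N *\<^sub>v w) $ i = (w $ i + w $ ((i + 1) mod N)) / 2"
    and "(D1_mat N h *\<^sub>v w) $ i = (w $ ((i + 1) mod N) - w $ ((i + N - 1) mod N)) / (2 * h)"
    and "(D2_mat N h *\<^sub>v w) $ i = (w $ ((i + 1) mod N) - w $ i) / h"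
    and "(D3_mat N h *\<^sub>v w) $ i
           = (w $ ((i + 1) mod N) - 2 * w $ i + w $ ((i + N - 1) mod N)) / h\<^sup>2"
proof -
  have pick: "(\<Sum>j = 0..<N. of_bool (j = k) * w $ j) = w $ k" if "k < N" for k
    using that by (simp add: of_bool_def if_distrib[of "\<lambda>x. x * _"] cong: if_cong)
  have lt: "(i + 1) mod N < N" "(i + N - 1) mod N < N"
    using i by auto
  note p = pick[OF i] pick[OF lt(1)] pick[OF lt(2)]
  have dw: "dim_vec w = N" using w by simp
  have mv: "(mat N N (\<lambda>(i, j). f i j) *\<^sub>v w) $ i = (\<Sum>j = 0..<N. f i j * w $ j)" for f
    using i dw by (auto simp: scalar_prod_def intro!: sum.cong)
  show "(avg_mat N *\<^sub>v w) $ i = (w $ i + w $ ((i + 1) mod N)) / 2"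
    unfolding avg_mat_def mv p[symmetric]
    by (simp only: sum.distrib[symmetric] sum_divide_distrib distrib_right times_divide_eq_left)
  show "(D1_mat N h *\<^sub>v w) $ i = (w $ ((i + 1) mod N) - w $ ((i + N - 1) mod N)) / (2 * h)"
    unfolding D1_mat_def mv p[symmetric]
    by (simp only: sum_subtractf[symmetric] sum_divide_distrib left_diff_distrib
          times_divide_eq_left)
  show "(D2_mat N h *\<^sub>v w) $ i = (w $ ((i + 1) mod N) - w $ i) / h"
    unfolding D2_mat_def mv p[symmetric]
    by (simp only: sum_subtractf[symmetric] sum_divide_distrib left_diff_distrib
          times_divide_eq_left)
  show "(D3_mat N h *\<^sub>v w) $ i
           = (w $ ((i + 1) mod N) - 2 * w $ i + w $ ((i + N - 1) mod N)) / h\<^sup>2"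
    unfolding D3_mat_def mv p[symmetric]
    by (simp only: sum_subtractf[symmetric] sum.distrib[symmetric] sum_distrib_left
          sum_divide_distrib left_diff_distrib distrib_right times_divide_eq_left mult.assoc)
qed


definition div_h :: "nat \<Rightarrow> nat \<Rightarrow> real \<Rightarrow> real \<Rightarrow> velocity \<Rightarrow> gridfun" where
  "div_h Nx Ny hx hy U = D2_mat Nx hx * fst U + snd U * transpose_mat (D2_mat Ny hy)"

definition grad_h :: "nat \<Rightarrow> nat \<Rightarrow> real \<Rightarrow> real \<Rightarrow> gridfun \<Rightarrow> velocity" where
  "grad_h Nx Ny hx hy P = (- (transpose_mat (D2_mat Nx hx) * P), - (P * D2_mat Ny hy))"

definition lap_h :: "nat \<Rightarrow> nat \<Rightarrow> real \<Rightarrow> real \<Rightarrow> gridfun \<Rightarrow> gridfun" where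
  "lap_h Nx Ny hx hy W = D3_mat Nx hx * W + W * transpose_mat (D3_mat Ny hy)"

definition vlap_h :: "nat \<Rightarrow> nat \<Rightarrow> real \<Rightarrow> real \<Rightarrow> velocity \<Rightarrow> velocity" where
  "vlap_h Nx Ny hx hy U = (lap_h Nx Ny hx hy (fst U), lap_h Nx Ny hx hy (snd U))"

definition G_map ::
  "nat \<Rightarrow> nat \<Rightarrow> real \<Rightarrow> real \<Rightarrow> (velocity \<Rightarrow> velocity) \<Rightarrow> velocity \<Rightarrow> velocity" where
  "G_map Nx Ny hx hy F W =
     (if vel_norm hx hy W = 0 then vzero Nx Ny
      else
        let A1 = avg_mat Nx; A2 = D1_mat Nx hx; A3 = D2_mat Nx hx;
            B1 = avg_mat Ny; B2 = D1_mat Ny hy; B3 = D2_mat Ny hy;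
            U = fst W; V = snd W
        in (1 / vel_inner hx hy (F W) W) *\<^sub>U
           (U \<odot> (A2 * U) - ((transpose_mat A1 * V) \<odot> (U * B3)) * transpose_mat B1,
            V \<odot> (V * transpose_mat B2) - A1 * ((transpose_mat A3 * V) \<odot> (U * B1))))"

definition B_map ::
  "nat \<Rightarrow> nat \<Rightarrow> real \<Rightarrow> real \<Rightarrow> (velocity \<Rightarrow> velocity) \<Rightarrow> velocity \<Rightarrow> velocity \<Rightarrow> velocity" where
  "B_map Nx Ny hx hy F U W =
     vel_inner hx hy (F U) W *\<^sub>U G_map Nx Ny hx hy F U
     - vel_inner hx hy (G_map Nx Ny hx hy F U) W *\<^sub>U F U"

text \<open>In the schemes, \<open>f\<close> is the sequence of discretized external forces; \<open>P 0\<close> and \<open>f 0\<close> are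
  not used.\<close>

definition bdf1_step ::
  "nat \<Rightarrow> nat \<Rightarrow> real \<Rightarrow> real \<Rightarrow> real \<Rightarrow> real \<Rightarrow> (velocity \<Rightarrow> velocity) \<Rightarrow> (nat \<Rightarrow> velocity)
   \<Rightarrow> (nat \<Rightarrow> velocity) \<Rightarrow> (nat \<Rightarrow> gridfun) \<Rightarrow> nat \<Rightarrow> bool" where
  "bdf1_step Nx Ny hx hy \<tau> \<nu> F f U P n \<longleftrightarrow>
     U (n + 1) \<in> velocity_space Nx Ny \<and> P (n + 1) \<in> pressure_space Nx Ny \<and>
     (1 / \<tau>) *\<^sub>U (U (n + 1) - U n) - \<nu> *\<^sub>U vlap_h Nx Ny hx hy (U (n + 1))
       + B_map Nx Ny hx hy F (U n) (U (n + 1)) + grad_h Nx Ny hx hy (P (n + 1)) = f (n + 1) \<and>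
     div_h Nx Ny hx hy (U (n + 1)) = 0\<^sub>m Nx Ny"

definition bdf1_scheme ::
  "nat \<Rightarrow> nat \<Rightarrow> nat \<Rightarrow> real \<Rightarrow> real \<Rightarrow> real \<Rightarrow> real \<Rightarrow> (velocity \<Rightarrow> velocity) \<Rightarrow> (nat \<Rightarrow> velocity)
   \<Rightarrow> (nat \<Rightarrow> velocity) \<Rightarrow> (nat \<Rightarrow> gridfun) \<Rightarrow> bool" where
  "bdf1_scheme Nx Ny Nt hx hy \<tau> \<nu> F f U P \<longleftrightarrow>
     U 0 \<in> velocity_space Nx Ny \<and>
     (\<forall>n\<in>{0..Nt - 1}. bdf1_step Nx Ny hx hy \<tau> \<nu> F f U P n)"

definition bdf2_step ::
  "nat \<Rightarrow> nat \<Rightarrow> real \<Rightarrow> real \<Rightarrow> real \<Rightarrow> real \<Rightarrow> (velocity \<Rightarrow> velocity) \<Rightarrow> (nat \<Rightarrow> velocity)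
   \<Rightarrow> (nat \<Rightarrow> velocity) \<Rightarrow> (nat \<Rightarrow> gridfun) \<Rightarrow> nat \<Rightarrow> bool" where
  "bdf2_step Nx Ny hx hy \<tau> \<nu> F f U P n \<longleftrightarrow>
     U (n + 1) \<in> velocity_space Nx Ny \<and> P (n + 1) \<in> pressure_space Nx Ny \<and>
     (1 / (2 * \<tau>)) *\<^sub>U (3 *\<^sub>U U (n + 1) - 4 *\<^sub>U U n + U (n - 1))
       - \<nu> *\<^sub>U vlap_h Nx Ny hx hy (U (n + 1))
       + B_map Nx Ny hx hy F (2 *\<^sub>U U n - U (n - 1)) (U (n + 1))
       + grad_h Nx Ny hx hy (P (n + 1)) = f (n + 1) \<and>
     div_h Nx Ny hx hy (U (n + 1)) = 0\<^sub>m Nx Ny"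

definition bdf2_scheme ::
  "nat \<Rightarrow> nat \<Rightarrow> nat \<Rightarrow> real \<Rightarrow> real \<Rightarrow> real \<Rightarrow> real \<Rightarrow> (velocity \<Rightarrow> velocity) \<Rightarrow> (nat \<Rightarrow> velocity)
   \<Rightarrow> (nat \<Rightarrow> velocity) \<Rightarrow> (nat \<Rightarrow> gridfun) \<Rightarrow> bool" where
  "bdf2_scheme Nx Ny Nt hx hy \<tau> \<nu> F f U P \<longleftrightarrow>
     U 0 \<in> velocity_space Nx Ny \<and>
     bdf1_step Nx Ny hx hy \<tau> \<nu> F f U P 0 \<and>
     (\<forall>n\<in>{1..Nt - 1}. bdf2_step Nx Ny hx hy \<tau> \<nu> F f U P n)"

definition energy :: "real \<Rightarrow> real \<Rightarrow> (nat \<Rightarrow> velocity) \<Rightarrow> nat \<Rightarrow> real" where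
  "energy hx hy U n = 1 / 2 * (vel_norm hx hy (U n))\<^sup>2"

text \<open>Meaningful for \<open>n \<ge> 1\<close> only.\<close>

definition energy_hat :: "real \<Rightarrow> real \<Rightarrow> (nat \<Rightarrow> velocity) \<Rightarrow> nat \<Rightarrow> real" where
  "energy_hat hx hy U n =
     1 / 4 * ((vel_norm hx hy (U n))\<^sup>2 + (vel_norm hx hy (2 *\<^sub>U U n - U (n - 1)))\<^sup>2)"

end

theory Submission
  imports Defs
begin

text \<open>
  The energy laws are what remains after the inner product of one time step with the new velocity
  \<open>W = U (n + 1)\<close> is taken. Two of the four terms then vanish.
  The nonlinearity \<open>B(U, W)\<close> is the skew combination \<open>(F, W) G - (G, W) F\<close>, so its inner product
  with \<open>W\<close> is \<open>(F, W) (G, W) - (G, W) (F, W) = 0\<close> (\<open>vel_inner_B_map\<close>). The pressure gradient is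
  minus the adjoint of the divergence (\<open>vel_inner_grad_h\<close>), so its inner product with the
  divergence-free \<open>W\<close> is zero. Hence the discrete time derivative \<open>D\<close>
  satisfies \<open>(D, W) = \<nu> (\<Delta> W, W)\<close>, see \<open>implicit_step_power_balance\<close>.

  It remains to rewrite \<open>(D, W)\<close>. Expanding squares, with
  \<open>a\<close>, \<open>b\<close>, \<open>c\<close> the new, the current and the previous velocity, gives
  \<open>2 (a - b, a) = |a|\<^sup>2 - |b|\<^sup>2 + |a - b|\<^sup>2\<close> for BDF1, and for BDF2 the G-stability identity
  \<open>2 (3 a - 4 b + c, a) = (|a|\<^sup>2 + |2 a - b|\<^sup>2) - (|b|\<^sup>2 + |2 b - c|\<^sup>2) + |a - 2 b + c|\<^sup>2\<close>.

  Matrices of unspecified size do not form a vector space, so the inner product is first written as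
  a sum over the entries, and its algebra is derived from that on matrices of equal size.
\<close>

section \<open>The inner product of grid functions\<close>

lemma grid_inner_eq_sum:
  assumes "A \<in> carrier_mat m n" "B \<in> carrier_mat m n"
  shows "grid_inner hx hy A B = hx * hy * (\<Sum>j<n. \<Sum>i<m. A $$ (i, j) * B $$ (i, j))"
  using assms
  by (auto simp: grid_inner_def mat_tr_def scalar_prod_def lessThan_atLeast0 intro!: sum.cong)

lemma grid_inner_commute:
  assumes "A \<in> carrier_mat m n" "B \<in> carrier_mat m n"
  shows "grid_inner hx hy A B = grid_inner hx hy B A"
  by (simp add: grid_inner_eq_sum[OF assms] grid_inner_eq_sum[OF assms(2,1)] mult.commute)

lemma grid_inner_add_left:
  assumes "A \<in> carrier_mat m n" "B \<in> carrier_mat m n" "C \<in> carrier_mat m n"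
  shows "grid_inner hx hy (A + B) C = grid_inner hx hy A C + grid_inner hx hy B C"
  using assms by (simp add: grid_inner_eq_sum[where m=m and n=n] distrib_right sum.distrib
      flip: distrib_left)

lemma grid_inner_diff_left:
  assumes "A \<in> carrier_mat m n" "B \<in> carrier_mat m n" "C \<in> carrier_mat m n"
  shows "grid_inner hx hy (A - B) C = grid_inner hx hy A C - grid_inner hx hy B C"
  using assms by (simp add: grid_inner_eq_sum[where m=m and n=n] left_diff_distrib sum_subtractf
      minus_carrier_mat flip: right_diff_distrib)

lemma grid_inner_smult_left:
  assumes "A \<in> carrier_mat m n" "B \<in> carrier_mat m n"
  shows "grid_inner hx hy (c \<cdot>\<^sub>m A) B = c * grid_inner hx hy A B"
  using assms by (simp add: grid_inner_eq_sum[where m=m and n=n] sum_distrib_left mult_ac)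

lemma grid_inner_uminus_left:
  assumes "A \<in> carrier_mat m n" "B \<in> carrier_mat m n"
  shows "grid_inner hx hy (- A) B = - grid_inner hx hy A B"
  using assms by (simp add: grid_inner_eq_sum[where m=m and n=n] sum_negf)

lemma grid_inner_zero_left:
  assumes "A \<in> carrier_mat m n"
  shows "grid_inner hx hy (0\<^sub>m m n) A = 0"
  using assms by (simp add: grid_inner_eq_sum[where m=m and n=n])

lemma grid_inner_self_nonneg:
  assumes "A \<in> carrier_mat m n" "hx \<ge> 0" "hy \<ge> 0"
  shows "grid_inner hx hy A A \<ge> 0"
  using assms by (simp add: grid_inner_eq_sum[where m=m and n=n] sum_nonneg)

lemma grid_inner_transpose:
  assumes "A \<in> carrier_mat m n" "B \<in> carrier_mat m n"
  shows "grid_inner hx hy (transpose_mat A) (transpose_mat B) = grid_inner hx hy A B"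
proof -
  have "grid_inner hx hy (transpose_mat A) (transpose_mat B)
      = hx * hy * (\<Sum>j<m. \<Sum>i<n. A $$ (j, i) * B $$ (j, i))"
    using assms by (simp add: grid_inner_eq_sum[where m=n and n=m])
  also have "\<dots> = grid_inner hx hy A B"
    unfolding grid_inner_eq_sum[OF assms] by (subst sum.swap) (rule refl)
  finally show ?thesis .
qed

lemma grid_inner_mult_left_adjoint:
  assumes M: "M \<in> carrier_mat k m" and P: "P \<in> carrier_mat k n" and U: "U \<in> carrier_mat m n"
  shows "grid_inner hx hy (transpose_mat M * P) U = grid_inner hx hy P (M * U)"
proof -
  have "transpose_mat (transpose_mat M * P) = transpose_mat P * M"
    using M P by (subst transpose_mult[of _ m k]) auto
  moreover have "transpose_mat P * M * U = transpose_mat P * (M * U)"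
    using M P U by (intro assoc_mult_mat) auto
  ultimately show ?thesis by (simp add: grid_inner_def)
qed

lemma grid_inner_mult_right_adjoint:
  assumes M: "M \<in> carrier_mat k m" and P: "P \<in> carrier_mat n k" and V: "V \<in> carrier_mat n m"
  shows "grid_inner hx hy (P * M) V = grid_inner hx hy P (V * transpose_mat M)"
proof -
  have "grid_inner hx hy (P * M) V
      = grid_inner hx hy (transpose_mat M * transpose_mat P) (transpose_mat V)"
    using assms grid_inner_transpose[of "P * M" n m V] transpose_mult[OF P M] by simp
  also have "\<dots> = grid_inner hx hy (transpose_mat P) (M * transpose_mat V)"
    using assms by (intro grid_inner_mult_left_adjoint) auto
  also have "M * transpose_mat V = transpose_mat (V * transpose_mat M)"
    using assms by (subst transpose_mult[of _ n m]) auto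
  also have "grid_inner hx hy (transpose_mat P) \<dots> = grid_inner hx hy P (V * transpose_mat M)"
    using assms by (intro grid_inner_transpose) auto
  finally show ?thesis .
qed

section \<open>The inner product of velocities\<close>

lemma velocity_space_closed:
  assumes "U \<in> velocity_space m n" "W \<in> velocity_space m n"
  shows "U + W \<in> velocity_space m n" "U - W \<in> velocity_space m n"
  using assms by (auto simp: velocity_space_def minus_carrier_mat)

lemma vscale_in_velocity_space [simp]:
  assumes "U \<in> velocity_space m n"
  shows "c *\<^sub>U U \<in> velocity_space m n"
  using assms by (auto simp: velocity_space_def vscale_def)

lemma
  assumes "U \<in> velocity_space m n" "V \<in> velocity_space m n" "W \<in> velocity_space m n"
  shows vel_inner_add_left:
      "vel_inner hx hy (U + V) W = vel_inner hx hy U W + vel_inner hx hy V W"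
    and vel_inner_diff_left:
      "vel_inner hx hy (U - V) W = vel_inner hx hy U W - vel_inner hx hy V W"
  using assms
  by (auto simp: velocity_space_def vel_inner_def grid_inner_add_left[where m=m and n=n]
      grid_inner_diff_left[where m=m and n=n])

lemma vel_inner_scale_left:
  assumes "U \<in> velocity_space m n" "W \<in> velocity_space m n"
  shows "vel_inner hx hy (c *\<^sub>U U) W = c * vel_inner hx hy U W"
  using assms
  by (auto simp: velocity_space_def vel_inner_def vscale_def
      grid_inner_smult_left[where m=m and n=n] distrib_left)

lemmas vel_inner_left = vel_inner_add_left vel_inner_diff_left vel_inner_scale_left

lemma vel_inner_commute:
  assumes "U \<in> velocity_space m n" "W \<in> velocity_space m n"
  shows "vel_inner hx hy U W = vel_inner hx hy W U"
  using assms
  by (auto simp: velocity_space_def vel_inner_def intro!: arg_cong2[of _ _ _ _ "(+)"]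
      grid_inner_commute)

lemma
  assumes "U \<in> velocity_space m n" "V \<in> velocity_space m n" "W \<in> velocity_space m n"
  shows vel_inner_add_right:
      "vel_inner hx hy W (U + V) = vel_inner hx hy W U + vel_inner hx hy W V"
    and vel_inner_diff_right:
      "vel_inner hx hy W (U - V) = vel_inner hx hy W U - vel_inner hx hy W V"
  using assms velocity_space_closed[OF assms(1,2)]
  by (simp_all add: vel_inner_commute[of W m n] vel_inner_left[where m=m and n=n])

lemma vel_inner_scale_right:
  assumes "U \<in> velocity_space m n" "W \<in> velocity_space m n"
  shows "vel_inner hx hy W (c *\<^sub>U U) = c * vel_inner hx hy W U"
  using assms by (simp add: vel_inner_commute[of W m n] vel_inner_scale_left[where m=m and n=n])

lemmas vel_inner_right = vel_inner_add_right vel_inner_diff_right vel_inner_scale_right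

lemma vel_norm_square:
  assumes "U \<in> velocity_space m n" "hx \<ge> 0" "hy \<ge> 0"
  shows "(vel_norm hx hy U)\<^sup>2 = vel_inner hx hy U U"
proof -
  have "vel_inner hx hy U U \<ge> 0"
    using assms by (auto simp: velocity_space_def vel_inner_def intro!: add_nonneg_nonneg
        grid_inner_self_nonneg)
  then show ?thesis by (simp add: vel_norm_def)
qed

lemma bdf1_polarization:
  assumes a: "a \<in> velocity_space m n" and b: "b \<in> velocity_space m n"
  shows "2 * vel_inner hx hy (a - b) a
    = vel_inner hx hy a a - vel_inner hx hy b b + vel_inner hx hy (a - b) (a - b)"
  using a b
  by (simp add: velocity_space_closed vel_inner_left[where m=m and n=n]
      vel_inner_right[where m=m and n=n] vel_inner_commute[OF b a])

text \<open>The quadratic form \<open>|a|\<^sup>2 + |2 a - b|\<^sup>2\<close> of two successive velocities is the one for which the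
  BDF2 difference telescopes up to a square; this is why \<open>energy_hat\<close> contains the extrapolated
  velocity.\<close>

lemma bdf2_polarization:
  assumes a: "a \<in> velocity_space m n" and b: "b \<in> velocity_space m n"
    and c: "c \<in> velocity_space m n"
  shows "2 * vel_inner hx hy (3 *\<^sub>U a - 4 *\<^sub>U b + c) a
    = (vel_inner hx hy a a + vel_inner hx hy (2 *\<^sub>U a - b) (2 *\<^sub>U a - b))
      - (vel_inner hx hy b b + vel_inner hx hy (2 *\<^sub>U b - c) (2 *\<^sub>U b - c))
      + vel_inner hx hy (a - 2 *\<^sub>U b + c) (a - 2 *\<^sub>U b + c)"
  using a b c
  by (simp add: velocity_space_closed vel_inner_left[where m=m and n=n]
      vel_inner_right[where m=m and n=n] vel_inner_commute[OF b a] vel_inner_commute[OF c a]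
      vel_inner_commute[OF c b] algebra_simps)

section \<open>Energy neutrality of the pressure and of the nonlinearity\<close>

lemma periodic_mat_carrier [simp]:
  "avg_mat N \<in> carrier_mat N N" "D1_mat N h \<in> carrier_mat N N"
  "D2_mat N h \<in> carrier_mat N N" "D3_mat N h \<in> carrier_mat N N"
  by (simp_all add: avg_mat_def D1_mat_def D2_mat_def D3_mat_def)

lemma periodic_mat_dim [simp]:
  "dim_row (avg_mat N) = N" "dim_col (avg_mat N) = N"
  "dim_row (D1_mat N h) = N" "dim_col (D1_mat N h) = N"
  "dim_row (D2_mat N h) = N" "dim_col (D2_mat N h) = N"
  by (simp_all add: avg_mat_def D1_mat_def D2_mat_def)

lemma grad_h_in_velocity_space:
  assumes "P \<in> pressure_space Nx Ny"
  shows "grad_h Nx Ny hx hy P \<in> velocity_space Nx Ny"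
  using assms
  by (auto simp: grad_h_def velocity_space_def pressure_space_def intro!: mult_carrier_mat)

lemma vlap_h_in_velocity_space:
  assumes "U \<in> velocity_space Nx Ny"
  shows "vlap_h Nx Ny hx hy U \<in> velocity_space Nx Ny"
  using assms
  by (auto simp: vlap_h_def lap_h_def velocity_space_def intro!: mult_carrier_mat add_carrier_mat)

lemma G_map_in_velocity_space:
  assumes "U \<in> velocity_space Nx Ny"
  shows "G_map Nx Ny hx hy F U \<in> velocity_space Nx Ny"
proof -
  obtain A B where U: "U = (A, B)" and A: "A \<in> carrier_mat Nx Ny" and B: "B \<in> carrier_mat Nx Ny"
    using assms by (auto simp: velocity_space_def)
  have "A \<odot> (D1_mat Nx hx * A)
      - ((transpose_mat (avg_mat Nx) * B) \<odot> (A * D2_mat Ny hy)) * transpose_mat (avg_mat Ny)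
      \<in> carrier_mat Nx Ny"
    by (rule carrier_matI) (simp_all add: hadamard_def)
  moreover have "B \<odot> (B * transpose_mat (D1_mat Ny hy))
      - avg_mat Nx * ((transpose_mat (D2_mat Nx hx) * B) \<odot> (A * avg_mat Ny))
      \<in> carrier_mat Nx Ny"
    using B by (intro carrier_matI) (simp_all add: hadamard_def)
  ultimately show ?thesis
    by (simp add: U G_map_def Let_def vzero_def vscale_def velocity_space_def)
qed

text \<open>The signs and transposes in \<open>grad_h\<close> are those of minus the adjoint of \<open>div_h\<close>: moving
  each difference matrix to the other side of the inner product is the periodic summation by parts,
  without boundary terms.\<close>

lemma vel_inner_grad_h:
  assumes P: "P \<in> pressure_space Nx Ny" and U: "U \<in> velocity_space Nx Ny"
  shows "vel_inner hx hy (grad_h Nx Ny hx' hy' P) U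
    = - grid_inner hx hy P (div_h Nx Ny hx' hy' U)"
proof -
  let ?A = "D2_mat Nx hx'" and ?B = "D2_mat Ny hy'"
  have P': "P \<in> carrier_mat Nx Ny" using P by (simp add: pressure_space_def)
  have U': "fst U \<in> carrier_mat Nx Ny" "snd U \<in> carrier_mat Nx Ny"
    using U by (auto simp: velocity_space_def)
  have AU: "?A * fst U \<in> carrier_mat Nx Ny" and VB: "snd U * transpose_mat ?B \<in> carrier_mat Nx Ny"
    and AP: "transpose_mat ?A * P \<in> carrier_mat Nx Ny" and PB: "P * ?B \<in> carrier_mat Nx Ny"
    using U' P' by (auto intro!: mult_carrier_mat)
  have "grid_inner hx hy P (div_h Nx Ny hx' hy' U)
      = grid_inner hx hy (?A * fst U) P + grid_inner hx hy (snd U * transpose_mat ?B) P"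
    using grid_inner_commute[OF P' add_carrier_mat[OF VB, of "?A * fst U"]]
      grid_inner_add_left[OF AU VB P'] by (simp add: div_h_def)
  also have "\<dots> = grid_inner hx hy P (?A * fst U) + grid_inner hx hy P (snd U * transpose_mat ?B)"
    by (simp add: grid_inner_commute[OF P' AU] grid_inner_commute[OF P' VB])
  also have "\<dots> = grid_inner hx hy (transpose_mat ?A * P) (fst U) + grid_inner hx hy (P * ?B) (snd U)"
    using grid_inner_mult_left_adjoint[OF periodic_mat_carrier(3) P' U'(1)]
      grid_inner_mult_right_adjoint[OF periodic_mat_carrier(3) P' U'(2)] by simp
  finally show ?thesis
    by (simp add: vel_inner_def grad_h_def grid_inner_uminus_left[OF AP U'(1)]
        grid_inner_uminus_left[OF PB U'(2)])
qed

lemma B_map_in_velocity_space: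
  assumes "U \<in> velocity_space Nx Ny" "F U \<in> velocity_space Nx Ny"
  shows "B_map Nx Ny hx hy F U W \<in> velocity_space Nx Ny"
  using assms by (simp add: B_map_def velocity_space_closed G_map_in_velocity_space)

text \<open>\<open>B(U, \<cdot>)\<close> is the operator \<open>W \<mapsto> (F, W) G - (G, W) F\<close>, which is skew-adjoint.\<close>

lemma vel_inner_B_map:
  assumes "U \<in> velocity_space Nx Ny" "F U \<in> velocity_space Nx Ny" "W \<in> velocity_space Nx Ny"
  shows "vel_inner hx hy (B_map Nx Ny hx hy F U W) W = 0"
  using assms
  by (simp add: B_map_def velocity_space_closed vel_inner_left[where m=Nx and n=Ny]
      G_map_in_velocity_space)

section \<open>The energy laws\<close>

text \<open>Both schemes have this form; they differ only in the difference quotient \<open>D\<close> and in the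
  velocity \<open>V\<close> at which \<open>F\<close> and \<open>G\<close> are evaluated.\<close>

lemma implicit_step_power_balance:
  assumes D: "D \<in> velocity_space Nx Ny" and V: "V \<in> velocity_space Nx Ny"
    and FV: "F V \<in> velocity_space Nx Ny"
    and W: "W \<in> velocity_space Nx Ny" and P: "P \<in> pressure_space Nx Ny"
    and step: "D - \<nu> *\<^sub>U vlap_h Nx Ny hx hy W + B_map Nx Ny hx hy F V W + grad_h Nx Ny hx hy P
      = vzero Nx Ny"
    and div_free: "div_h Nx Ny hx hy W = 0\<^sub>m Nx Ny"
  shows "vel_inner hx hy D W = \<nu> * vel_inner hx hy (vlap_h Nx Ny hx hy W) W"
proof -
  note [simp] = D W velocity_space_closed vlap_h_in_velocity_space[OF W]
    B_map_in_velocity_space[where F=F, OF V FV] grad_h_in_velocity_space[OF P]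
  have P': "P \<in> carrier_mat Nx Ny" using P by (simp add: pressure_space_def)
  have "vel_inner hx hy (grad_h Nx Ny hx hy P) W = 0"
    using grid_inner_commute[OF P' zero_carrier_mat] grid_inner_zero_left[OF P']
    by (simp add: vel_inner_grad_h[OF P W] div_free)
  moreover have "vel_inner hx hy (vzero Nx Ny) W = 0"
    using W by (auto simp: vel_inner_def vzero_def velocity_space_def grid_inner_zero_left)
  ultimately show ?thesis
    using arg_cong[OF step, of "\<lambda>X. vel_inner hx hy X W"] vel_inner_B_map[where F=F, OF V FV W]
    by (simp add: vel_inner_left[where m=Nx and n=Ny])
qed

lemma bdf1_step_energy_law:
  assumes h: "hx \<ge> 0" "hy \<ge> 0" and \<tau>: "\<tau> \<noteq> 0"
    and F: "F (U n) \<in> velocity_space Nx Ny"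
    and Un: "U n \<in> velocity_space Nx Ny"
    and step: "bdf1_step Nx Ny hx hy \<tau> \<nu> F f U P n" and f: "f (n + 1) = vzero Nx Ny"
  shows "(energy hx hy U (n + 1) - energy hx hy U n) / \<tau>
    = \<nu> * vel_inner hx hy (vlap_h Nx Ny hx hy (U (n + 1))) (U (n + 1))
      - 1 / (2 * \<tau>) * (vel_norm hx hy (U (n + 1) - U n))\<^sup>2"
proof -
  let ?a = "U (n + 1)" and ?b = "U n"
  have a: "?a \<in> velocity_space Nx Ny" using step by (simp add: bdf1_step_def)
  have D: "?a - ?b \<in> velocity_space Nx Ny" by (intro velocity_space_closed a Un)
  have "vel_inner hx hy ((1 / \<tau>) *\<^sub>U (?a - ?b)) ?a
      = \<nu> * vel_inner hx hy (vlap_h Nx Ny hx hy ?a) ?a"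
    using step f Un F D
    by (intro implicit_step_power_balance[where V="?b" and F=F and P="P (n + 1)"])
      (auto simp: bdf1_step_def)
  then have "\<nu> * vel_inner hx hy (vlap_h Nx Ny hx hy ?a) ?a
      = 1 / (2 * \<tau>) * (2 * vel_inner hx hy (?a - ?b) ?a)"
    using vel_inner_scale_left[OF D a, of hx hy "1 / \<tau>"] by simp
  then show ?thesis
    unfolding bdf1_polarization[OF a Un] energy_def
      vel_norm_square[OF a h] vel_norm_square[OF Un h] vel_norm_square[OF D h]
    using \<tau> by (simp add: field_simps)
qed

lemma bdf2_step_energy_law:
  assumes h: "hx \<ge> 0" "hy \<ge> 0" and \<tau>: "\<tau> \<noteq> 0"
    and F: "F (2 *\<^sub>U U n - U (n - 1)) \<in> velocity_space Nx Ny"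
    and Un: "U n \<in> velocity_space Nx Ny" and Un': "U (n - 1) \<in> velocity_space Nx Ny"
    and step: "bdf2_step Nx Ny hx hy \<tau> \<nu> F f U P n" and f: "f (n + 1) = vzero Nx Ny"
  shows "(energy_hat hx hy U (n + 1) - energy_hat hx hy U n) / \<tau>
    = \<nu> * vel_inner hx hy (vlap_h Nx Ny hx hy (U (n + 1))) (U (n + 1))
      - 1 / (4 * \<tau>) * (vel_norm hx hy (U (n + 1) - 2 *\<^sub>U U n + U (n - 1)))\<^sup>2"
proof -
  let ?a = "U (n + 1)" and ?b = "U n" and ?c = "U (n - 1)"
  let ?D = "3 *\<^sub>U ?a - 4 *\<^sub>U ?b + ?c"
  have a: "?a \<in> velocity_space Nx Ny" using step by (simp add: bdf2_step_def)
  note closed = velocity_space_closed vscale_in_velocity_space a Un Un'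
  have D: "?D \<in> velocity_space Nx Ny"
    and extrapolation: "2 *\<^sub>U ?b - ?c \<in> velocity_space Nx Ny" "2 *\<^sub>U ?a - ?b \<in> velocity_space Nx Ny"
    and increment: "?a - 2 *\<^sub>U ?b + ?c \<in> velocity_space Nx Ny"
    by (intro closed)+
  have "vel_inner hx hy ((1 / (2 * \<tau>)) *\<^sub>U ?D) ?a
      = \<nu> * vel_inner hx hy (vlap_h Nx Ny hx hy ?a) ?a"
  proof (rule implicit_step_power_balance[where V="2 *\<^sub>U ?b - ?c" and F=F and P="P (n + 1)"])
    show "(1 / (2 * \<tau>)) *\<^sub>U ?D \<in> velocity_space Nx Ny"
      using D by (rule vscale_in_velocity_space)
  qed (use step f F extrapolation in \<open>simp_all add: bdf2_step_def\<close>)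
  then have balance: "\<nu> * vel_inner hx hy (vlap_h Nx Ny hx hy ?a) ?a
      = 1 / (4 * \<tau>) * (2 * vel_inner hx hy ?D ?a)"
    using vel_inner_scale_left[OF D a, of hx hy "1 / (2 * \<tau>)"] by simp
  show ?thesis
    unfolding balance bdf2_polarization[OF a Un Un'] energy_hat_def add_diff_cancel_right'
      vel_norm_square[OF a h] vel_norm_square[OF Un h] vel_norm_square[OF increment h]
      vel_norm_square[OF extrapolation(1) h] vel_norm_square[OF extrapolation(2) h]
    using \<tau> by (simp add: field_simps)
qed

theorem theorem4p3:
  fixes Nx Ny Nt :: nat
    and Lx Ly T \<nu> hx hy \<tau> :: real
    and F :: "velocity \<Rightarrow> velocity"
    and f :: "nat \<Rightarrow> velocity"
  assumes "Nx > 0" "Ny > 0" "Nt > 0"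
    and "Lx > 0" "Ly > 0" "T > 0" "\<nu> > 0"
    and "hx = Lx / real Nx" "hy = Ly / real Ny" "\<tau> = T / real Nt"
    and "\<And>W. W \<in> velocity_space Nx Ny \<Longrightarrow> F W \<in> velocity_space Nx Ny"
    and "\<And>W. W \<in> velocity_space Nx Ny \<Longrightarrow> vel_norm hx hy W \<noteq> 0 \<Longrightarrow> vel_inner hx hy (F W) W \<noteq> 0"
    and "\<And>n. n \<in> {1..Nt} \<Longrightarrow> f n = vzero Nx Ny"
  shows "(\<forall>U P. bdf1_scheme Nx Ny Nt hx hy \<tau> \<nu> F f U P \<longrightarrow>
            (\<forall>n\<in>{0..Nt - 1}.
               (energy hx hy U (n + 1) - energy hx hy U n) / \<tau>
               = \<nu> * vel_inner hx hy (vlap_h Nx Ny hx hy (U (n + 1))) (U (n + 1))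
                 - 1 / (2 * \<tau>) * (vel_norm hx hy (U (n + 1) - U n))\<^sup>2)) \<and>
         (\<forall>U P. bdf2_scheme Nx Ny Nt hx hy \<tau> \<nu> F f U P \<longrightarrow>
            (\<forall>n\<in>{1..Nt - 1}.
               (energy_hat hx hy U (n + 1) - energy_hat hx hy U n) / \<tau>
               = \<nu> * vel_inner hx hy (vlap_h Nx Ny hx hy (U (n + 1))) (U (n + 1))
                 - 1 / (4 * \<tau>) * (vel_norm hx hy (U (n + 1) - 2 *\<^sub>U U n + U (n - 1)))\<^sup>2))"
proof -
  have h: "hx \<ge> 0" "hy \<ge> 0" and \<tau>: "\<tau> \<noteq> 0"
    using assms by simp_all
  note F = assms(11) and f = assms(13)
  have f0: "f (n + 1) = vzero Nx Ny" if "n \<le> Nt - 1" for n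
    using that \<open>Nt > 0\<close> by (intro f) auto
  have bdf1: "(energy hx hy U (n + 1) - energy hx hy U n) / \<tau>
      = \<nu> * vel_inner hx hy (vlap_h Nx Ny hx hy (U (n + 1))) (U (n + 1))
        - 1 / (2 * \<tau>) * (vel_norm hx hy (U (n + 1) - U n))\<^sup>2"
    if scheme: "bdf1_scheme Nx Ny Nt hx hy \<tau> \<nu> F f U P" and n: "n \<in> {0..Nt - 1}" for U P n
  proof -
    have "U n \<in> velocity_space Nx Ny"
      using scheme n by (cases n) (auto simp: bdf1_scheme_def bdf1_step_def)
    with scheme n F f0 show ?thesis
      by (intro bdf1_step_energy_law[OF h \<tau>, where F=F and f=f and P=P]) (auto simp: bdf1_scheme_def)
  qed
  have bdf2: "(energy_hat hx hy U (n + 1) - energy_hat hx hy U n) / \<tau>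
      = \<nu> * vel_inner hx hy (vlap_h Nx Ny hx hy (U (n + 1))) (U (n + 1))
        - 1 / (4 * \<tau>) * (vel_norm hx hy (U (n + 1) - 2 *\<^sub>U U n + U (n - 1)))\<^sup>2"
    if scheme: "bdf2_scheme Nx Ny Nt hx hy \<tau> \<nu> F f U P" and n: "n \<in> {1..Nt - 1}" for U P n
  proof -
    have U: "U k \<in> velocity_space Nx Ny" if k: "k \<le> Nt - 1" for k
    proof -
      \<comment> \<open>The first two velocities come from the initial datum and the BDF1 start-up step.\<close>
      consider "k = 0" | "k = 1" | "k - 1 \<in> {1..Nt - 1}" "k - 1 + 1 = k"
        using k by (cases "k \<le> 1") force+
      then show ?thesis
      proof cases
        case 3
        then have "bdf2_step Nx Ny hx hy \<tau> \<nu> F f U P (k - 1)"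
          using scheme by (simp add: bdf2_scheme_def)
        then show ?thesis
          unfolding bdf2_step_def 3(2) by simp
      qed (use scheme in \<open>auto simp: bdf2_scheme_def bdf1_step_def\<close>)
    qed
    have Un: "U n \<in> velocity_space Nx Ny" and Un': "U (n - 1) \<in> velocity_space Nx Ny"
      using n by (auto intro!: U)
    have "F (2 *\<^sub>U U n - U (n - 1)) \<in> velocity_space Nx Ny"
      using Un Un' by (intro F velocity_space_closed vscale_in_velocity_space)
    then show ?thesis
      using scheme n f0 Un Un'
      by (intro bdf2_step_energy_law[OF h \<tau>, where F=F and f=f and P=P]) (auto simp: bdf2_scheme_def)
  qed
  show ?thesis
    using bdf1 bdf2 by blast
qed

end
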